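(* Let $\mu^+$ be a finite nonnegative Borel measure on $[0,\infty)$ whose support is unbounded, and assume $\inf_{s>0}M_{s,\sigma_s}(e_s)>0$ and that $s\mapsto\nu_s(A)$ is $\mu^+$-measurable for every Borel $A$. Then there exists $u\in C^\infty_c(B_1)$ such that $$\int_{[0,\infty)}\mathcal E_{2s_1,s}(u,u)\,\mu^+(ds)=+\infty.$$
   Context: For $s>0$, $\sigma_s$ is a Borel probability measure on $\mathbb S^{N-1}$ and $\nu_s(U)=\int_0^\infty\int_{\mathbb S^{N-1}}\chi_U(r\theta)r^{-1-2s}\sigma_s(d\theta)\,dr$; $M_{s,\sigma}(e)=\int|e\cdot\theta|^{2s}\sigma(d\theta)$; $e_s$ a maximum point of $M_{s,\sigma_s}$; for integer $k>s$, $\frac2{c_{k,s}}=2^k\int(1-\cos(e_s\cdot y))^k\nu_s(dy)$; $\delta_mu(x,y)=\sum_{j=-m}^m(-1)^j\binom{2m}{m-j}u(x+jy)$. For $s\ge0$, $s_1=\min\{n\in\mathbb Z:n>s\}$; for $s>0$, $\mathcal E_{2s_1,s}(u,u)=\frac{c_{2s_1,s}}2\iint_{\mathbb R^{2N}}(\delta_{s_1}u(x,y))^2dx\,\nu_s(dy)$, and $\mathcal E_{2,0}(u,u)=\|u\|^2_{L^2(\mathbb R^N)}$. $B_1$ is the unit ball of $\mathbb R^N$. *)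

theory Defs
  imports "HOL-Analysis.Analysis" "HOL-Probability.Probability"
begin

coinductive Cinf :: "('a::euclidean_space \<Rightarrow> real) \<Rightarrow> bool" where
  "(\<forall>x. f differentiable (at x)) \<Longrightarrow>
   (\<forall>b\<in>Basis. Cinf (\<lambda>x. frechet_derivative f (at x) b)) \<Longrightarrow> Cinf f"

definition fun_support :: "('a::euclidean_space \<Rightarrow> real) \<Rightarrow> 'a set" where
  "fun_support u = closure {x. u x \<noteq> 0}"

definition Cc_inf :: "'a::euclidean_space set \<Rightarrow> ('a \<Rightarrow> real) set" where
  "Cc_inf U = {u. Cinf u \<and> compact (fun_support u) \<and> fun_support u \<subseteq> U}"

definition measure_support :: "real measure \<Rightarrow> real set" where
  "measure_support M = {x. \<forall>e>0. emeasure M (ball x e) > 0}"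

definition nu_meas :: "real \<Rightarrow> 'a::euclidean_space measure \<Rightarrow> 'a measure" where
  "nu_meas s sg = measure_of UNIV (sets borel)
     (\<lambda>U. nn_integral lborel (\<lambda>r. indicator {0<..} r *
        nn_integral sg (\<lambda>th. indicator U (r *\<^sub>R th) * ennreal (r powr (-1 - 2 * s)))))"

definition M_fun :: "real \<Rightarrow> 'a::euclidean_space measure \<Rightarrow> 'a \<Rightarrow> real" where
  "M_fun s sg e = (\<integral>th. \<bar>e \<bullet> th\<bar> powr (2 * s) \<partial>sg)"

definition c_const :: "nat \<Rightarrow> real \<Rightarrow> 'a::euclidean_space measure \<Rightarrow> 'a \<Rightarrow> real" where
  "c_const k s sg es = 2 / (2^k * enn2real (\<integral>\<^sup>+ y. ennreal ((1 - cos (es \<bullet> y))^k) \<partial>nu_meas s sg))"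

definition delta_op :: "nat \<Rightarrow> ('a::real_vector \<Rightarrow> real) \<Rightarrow> 'a \<Rightarrow> 'a \<Rightarrow> real" where
  "delta_op m u x y = (\<Sum>j\<in>{-int m..int m}.
      (-1) ^ nat \<bar>j\<bar> * real ((2 * m) choose nat (int m - j)) * u (x + of_int j *\<^sub>R y))"

definition s_one :: "real \<Rightarrow> nat" where
  "s_one s = nat (\<lfloor>s\<rfloor> + 1)"

definition energy :: "real \<Rightarrow> 'a::euclidean_space measure \<Rightarrow> 'a \<Rightarrow> ('a \<Rightarrow> real) \<Rightarrow> ennreal" where
  "energy s sg es u =
     (if s = 0 then \<integral>\<^sup>+ x. ennreal ((u x)^2) \<partial>lborel
      else ennreal (c_const (2 * s_one s) s sg es / 2) *
        (\<integral>\<^sup>+ y. (\<integral>\<^sup>+ x. ennreal ((delta_op (s_one s) u x y)^2) \<partial>lborel) \<partial>nu_meas s sg))"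

end

theory Submission
  imports Defs
begin

text \<open>
The energy of order $s$ is bounded below by a constant depending only on $m = s_1$ times
$\int_0^\infty r^{-1-2s} \|\delta_m u(\cdot, r\theta)\|_2^2\,dr$, uniformly in the unit vector
$\theta$, because the normalising constant satisfies $c_{2m,s} \ge 2 / (4^m (1 + 4^m))$ for
$m - 1 \le s < m$ and $m \ge 2$. Take $u = \sum_k \varepsilon_k^{\lfloor k/2 \rfloor}
\phi((x - X_k)/\varepsilon_k)$ with $\phi$ a radial bump and disjointly supported summands.
Any sufficiently small scales $\varepsilon_k$ make $u$ smooth, whereas for every $m > N + 2$ the $m$-th
summand alone contributes at least a constant times $\varepsilon_m^{N + 2 - m}$ to the
energies of orders $s \in [m - 1, m)$. As infinitely many of these intervals have positive
$\mu^+$-measure, the scales can be chosen so that each of them contributes at least $1$.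
\<close>

subsection \<open>Integration in polar form\<close>

text \<open>The countable additivity needed for \<^const>\<open>measure_of\<close> not to be the zero measure comes from
  exhibiting \<open>nu_meas s sg\<close> as an image of a measure on a product space.\<close>
lemma nn_integral_nu_meas:
  fixes sg :: "'a::euclidean_space measure" and f :: "'a \<Rightarrow> ennreal"
  assumes "prob_space sg" and sg: "sets sg = sets borel"
    and f: "f \<in> borel_measurable borel"
  shows "(\<integral>\<^sup>+ y. f y \<partial>nu_meas s sg) =
    (\<integral>\<^sup>+ th. (\<integral>\<^sup>+ r. indicator {0<..} r * ennreal (r powr (-1 - 2 * s)) * f (r *\<^sub>R th) \<partial>lborel) \<partial>sg)"
proof -
  interpret sg: prob_space sg by fact
  interpret P: pair_sigma_finite lborel sg ..
  note [measurable_cong] = sg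
  note f[measurable]
  define w where "w = (\<lambda>r::real. indicator {0<..} r * ennreal (r powr (-1 - 2 * s)))"
  have w[measurable]: "w \<in> borel_measurable borel" unfolding w_def by measurable
  define P where "P = density (lborel \<Otimes>\<^sub>M sg) (\<lambda>z. w (fst z))"
  define D where "D = distr P borel (\<lambda>z. fst z *\<^sub>R snd z)"
  have [measurable]: "(\<lambda>z. fst z *\<^sub>R snd z) \<in> P \<rightarrow>\<^sub>M borel"
    unfolding P_def by measurable
  have D_int: "(\<integral>\<^sup>+ y. g y \<partial>D) = (\<integral>\<^sup>+ z. w (fst z) * g (fst z *\<^sub>R snd z) \<partial>(lborel \<Otimes>\<^sub>M sg))"
    if [measurable]: "g \<in> borel_measurable borel" for g
  proof -
    have "(\<integral>\<^sup>+ y. g y \<partial>D) = (\<integral>\<^sup>+ z. g (fst z *\<^sub>R snd z) \<partial>P)"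
      unfolding D_def by (rule nn_integral_distr) measurable
    also have "\<dots> = (\<integral>\<^sup>+ z. w (fst z) * g (fst z *\<^sub>R snd z) \<partial>(lborel \<Otimes>\<^sub>M sg))"
      unfolding P_def by (rule nn_integral_density) measurable
    finally show ?thesis .
  qed
  have "nu_meas s sg = measure_of (space D) (sets D) (emeasure D)"
  proof -
    have "emeasure D U = (\<integral>\<^sup>+ r. indicator {0<..} r *
        (\<integral>\<^sup>+ th. indicator U (r *\<^sub>R th) * ennreal (r powr (-1 - 2 * s)) \<partial>sg) \<partial>lborel)"
      if [measurable]: "U \<in> sets borel" for U
    proof -
      have "emeasure D U = (\<integral>\<^sup>+ y. indicator U y \<partial>D)"
        using that by (simp add: D_def)
      also have "\<dots> = (\<integral>\<^sup>+ z. w (fst z) * indicator U (fst z *\<^sub>R snd z) \<partial>(lborel \<Otimes>\<^sub>M sg))"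
        by (rule D_int) measurable
      also have "\<dots> = (\<integral>\<^sup>+ r. (\<integral>\<^sup>+ th. w r * indicator U (r *\<^sub>R th) \<partial>sg) \<partial>lborel)"
        by (subst sg.nn_integral_fst[symmetric]) simp_all
      also have "\<dots> = (\<integral>\<^sup>+ r. indicator {0<..} r *
        (\<integral>\<^sup>+ th. indicator U (r *\<^sub>R th) * ennreal (r powr (-1 - 2 * s)) \<partial>sg) \<partial>lborel)"
        unfolding w_def
        by (intro nn_integral_cong, subst nn_integral_cmult[symmetric]) (auto intro!: nn_integral_cong simp: ac_simps)
      finally show ?thesis .
    qed
    moreover have "sigma_sets (UNIV :: 'a set) (sets borel) = sets borel"
      using sets.sigma_sets_eq[of "borel :: 'a measure"] by simp
    ultimately have "nu_meas s sg = measure_of UNIV (sets borel) (emeasure D)"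
      unfolding nu_meas_def by (intro measure_of_eq) auto
    then show ?thesis by (simp add: D_def)
  qed
  then have "nu_meas s sg = D"
    by (simp add: measure_of_of_measure)
  then have "(\<integral>\<^sup>+ y. f y \<partial>nu_meas s sg) = (\<integral>\<^sup>+ z. w (fst z) * f (fst z *\<^sub>R snd z) \<partial>(lborel \<Otimes>\<^sub>M sg))"
    using D_int[OF f] by simp
  \<comment> \<open>Tonelli, with the radial integral now innermost: the later estimates are made
    along a fixed ray and are uniform in the direction.\<close>
  also have "\<dots> = (\<integral>\<^sup>+ th. (\<integral>\<^sup>+ r. w r * f (r *\<^sub>R th) \<partial>lborel) \<partial>sg)"
    by (subst P.nn_integral_snd[symmetric]) (simp_all add: case_prod_beta)
  finally show ?thesis by (simp add: w_def)
qed

subsection \<open>Smooth bump series\<close>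

text \<open>Derivatives are unique, so the coinduction may use any derivative \<open>f'\<close>
  produced by calculus rules in place of \<open>frechet_derivative\<close>.\<close>

lemma Cinf_coinduct_derivative:
  assumes "P f"
    and "\<And>f. P f \<Longrightarrow> \<exists>f'. (\<forall>x. (f has_derivative f' x) (at x)) \<and> (\<forall>b\<in>Basis. P (\<lambda>x. f' x b))"
  shows "Cinf f"
  using assms(1)
proof (coinduction arbitrary: f)
  case Cinf
  obtain f' where f': "\<And>x. (f has_derivative f' x) (at x)" "\<And>b. b \<in> Basis \<Longrightarrow> P (\<lambda>x. f' x b)"
    using assms(2)[OF Cinf] by blast
  have "frechet_derivative f (at x) = f' x" for x
    using frechet_derivative_at[OF f'(1)] by simp
  with f' show ?case
    by (auto simp: differentiable_def)
qed

section \<open>Derivatives and continuity of smooth functions\<close>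

lemma Cinf_has_derivative:
  "Cinf f \<Longrightarrow> (f has_derivative frechet_derivative f (at x)) (at x)"
  by (erule Cinf.cases) (auto simp: frechet_derivative_works)

lemma Cinf_partial:
  "Cinf f \<Longrightarrow> b \<in> Basis \<Longrightarrow> Cinf (\<lambda>x. frechet_derivative f (at x) b)"
  by (erule Cinf.cases) auto

lemma Cinf_continuous_on: "Cinf f \<Longrightarrow> continuous_on A f"
  by (meson Cinf_has_derivative continuous_at_imp_continuous_on has_derivative_continuous)

text \<open>For \<open>n = 0\<close> this is the classical smooth function that is flat at 0. The
  powers of \<open>1 / t\<close> close the family under differentiation up to linear
  combinations.\<close>

definition flat_exp :: "nat \<Rightarrow> real \<Rightarrow> real" where
  "flat_exp n t = (if t > 0 then (1 / t) ^ n * exp (- (1 / t)) else 0)"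

lemma has_real_derivative_flat_exp:
  "(flat_exp n has_real_derivative (flat_exp (n + 2) t - real n * flat_exp (n + 1) t)) (at t)"
proof -
  consider "t > 0" | "t < 0" | "t = 0" by linarith
  then show ?thesis
  proof cases
    case 1
    have "((\<lambda>t. (1 / t) ^ n * exp (- (1 / t))) has_real_derivative
        (flat_exp (n + 2) t - real n * flat_exp (n + 1) t)) (at t)"
      using 1
      apply (cases n)
       apply (auto intro!: derivative_eq_intros simp: flat_exp_def field_simps power2_eq_square)
      subgoal for k by (cases k) auto
      done
    then show ?thesis
      by (rule has_field_derivative_transform_within_open[where S = "{0<..}"])
         (use 1 in \<open>auto simp: flat_exp_def\<close>)
  next
    case 2
    have "((\<lambda>t. 0) has_real_derivative (flat_exp (n + 2) t - real n * flat_exp (n + 1) t)) (at t)"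
      using 2 by (simp add: flat_exp_def)
    then show ?thesis
      by (rule has_field_derivative_transform_within_open[where S = "{..<0}"])
         (use 2 in \<open>auto simp: flat_exp_def\<close>)
  next
    case 3
    \<comment> \<open>At 0 the right difference quotient is \<open>x ^ (n + 1) * exp (- x)\<close>
      with \<open>x = 1 / h\<close> tending to infinity.\<close>
    have "((\<lambda>h::real. inverse h ^ Suc n / exp (inverse h)) \<longlongrightarrow> 0) (at_right 0)"
      by (rule filterlim_compose[OF tendsto_power_div_exp_0 filterlim_inverse_at_top_right])
    then have "((\<lambda>h. flat_exp n h / h) \<longlongrightarrow> 0) (at_right 0)"
      by (rule Lim_transform_eventually)
         (auto simp: flat_exp_def eventually_at_filter exp_minus field_simps)
    moreover have "((\<lambda>h. flat_exp n h / h) \<longlongrightarrow> 0) (at_left 0)"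
      by (rule Lim_transform_eventually[OF tendsto_const])
         (auto simp: flat_exp_def eventually_at_filter)
    ultimately have "((\<lambda>h. flat_exp n h / h) \<longlongrightarrow> 0) (at 0)"
      by (simp add: filterlim_split_at)
    then show ?thesis
      using 3 by (simp add: DERIV_def flat_exp_def)
  qed
qed

text \<open>The point of this class is its closure under partial derivatives, which makes the coinduction
  for \<^const>\<open>Cinf\<close> immediate.\<close>
inductive bump_alg :: "('a::euclidean_space \<Rightarrow> real) \<Rightarrow> bool" where
  const: "bump_alg (\<lambda>x. c)"
| inner: "bump_alg (\<lambda>x. x \<bullet> b)"
| flat: "bump_alg (\<lambda>x. flat_exp n (1 - x \<bullet> x))"
| add: "bump_alg f \<Longrightarrow> bump_alg g \<Longrightarrow> bump_alg (\<lambda>x. f x + g x)"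
| mult: "bump_alg f \<Longrightarrow> bump_alg g \<Longrightarrow> bump_alg (\<lambda>x. f x * g x)"

lemma bump_alg_derivative:
  assumes "bump_alg f"
  shows "\<exists>f'. (\<forall>x. (f has_derivative f' x) (at x)) \<and> (\<forall>b. bump_alg (\<lambda>x. f' x b))"
  using assms
proof induction
  case (const c)
  show ?case by (rule exI[of _ "\<lambda>x h. 0"]) (auto intro: bump_alg.const)
next
  case (inner b)
  show ?case
    by (rule exI[of _ "\<lambda>x h. h \<bullet> b"]) (auto intro!: bump_alg.const derivative_eq_intros)
next
  case (flat n)
  \<comment> \<open>A sum with a constant factor replaces the difference, so that the closure rules
    of \<open>bump_alg\<close> apply literally.\<close>
  let ?d = "\<lambda>t. flat_exp (n + 2) t + (- real n) * flat_exp (n + 1) t"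
  have "((\<lambda>x. flat_exp n (1 - x \<bullet> x)) has_derivative (\<lambda>h. ?d (1 - x \<bullet> x) * (- 2 * (x \<bullet> h)))) (at x)" for x :: 'a
  proof -
    have "((\<lambda>x. 1 - x \<bullet> x) has_derivative (\<lambda>h. - 2 * (x \<bullet> h))) (at x)"
      by (auto intro!: derivative_eq_intros simp: inner_commute)
    from has_derivative_compose[OF this has_real_derivative_flat_exp[THEN has_field_derivative_imp_has_derivative]]
    show ?thesis by (simp add: mult.commute)
  qed
  moreover have "bump_alg (\<lambda>x::'a. ?d (1 - x \<bullet> x) * (- 2 * (x \<bullet> b)))" for b
    by (intro bump_alg.intros)
  ultimately show ?case
    by (intro exI[of _ "\<lambda>x h. ?d (1 - x \<bullet> x) * (- 2 * (x \<bullet> h))"]) blast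
next
  case (add f g)
  then obtain f' g' where "\<And>x. (f has_derivative f' x) (at x)" "\<And>b. bump_alg (\<lambda>x. f' x b)"
    "\<And>x. (g has_derivative g' x) (at x)" "\<And>b. bump_alg (\<lambda>x. g' x b)" by blast
  then show ?case
    by (intro exI[of _ "\<lambda>x h. f' x h + g' x h"]) (auto intro!: bump_alg.add has_derivative_add)
next
  case (mult f g)
  then obtain f' g' where "\<And>x. (f has_derivative f' x) (at x)" "\<And>b. bump_alg (\<lambda>x. f' x b)"
    "\<And>x. (g has_derivative g' x) (at x)" "\<And>b. bump_alg (\<lambda>x. g' x b)" by blast
  with mult.hyps show ?case
    by (intro exI[of _ "\<lambda>x h. f x * g' x h + f' x h * g x"])
       (auto intro!: bump_alg.add bump_alg.mult has_derivative_mult)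
qed

lemma bump_alg_Cinf: "bump_alg f \<Longrightarrow> Cinf f"
  by (rule Cinf_coinduct_derivative[where P = bump_alg]) (use bump_alg_derivative in blast)+

section \<open>Bounds for smooth functions vanishing outside the unit ball\<close>

lemma Cinf_zero_outside_bounded:
  fixes f :: "'a::euclidean_space \<Rightarrow> real"
  assumes "Cinf f" and zero: "\<And>x. norm x > 1 \<Longrightarrow> f x = 0"
  obtains K where "\<And>x. \<bar>f x\<bar> \<le> K"
proof -
  have "bounded (f ` cball 0 1)"
    using assms by (intro compact_imp_bounded compact_continuous_image Cinf_continuous_on) auto
  then obtain K where K: "\<And>x. x \<in> cball 0 1 \<Longrightarrow> \<bar>f x\<bar> \<le> K"
    unfolding bounded_iff by (metis imageI real_norm_def)
  have "\<bar>f x\<bar> \<le> K" for x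
    using K[of x] K[of 0] zero[of x] by (cases "norm x \<le> 1") auto
  then show thesis by (rule that)
qed

lemma frechet_derivative_zero_outside:
  fixes f :: "'a::euclidean_space \<Rightarrow> real"
  assumes "\<And>x. norm x > 1 \<Longrightarrow> f x = 0" and "norm x > 1"
  shows "frechet_derivative f (at x) = (\<lambda>h. 0)"
proof -
  have "((\<lambda>x. 0) has_derivative (\<lambda>h. 0)) (at x)" by simp
  then have "(f has_derivative (\<lambda>h. 0)) (at x)"
    by (rule has_derivative_transform_within_open[where s = "- cball 0 1"]) (use assms in auto)
  from frechet_derivative_at[OF this] show ?thesis by simp
qed

text \<open>Expand \<open>h\<close> in the basis: each partial derivative is again smooth and zero
  outside the closed unit ball, hence bounded. The bound provides the dominating series for termwise
  differentiation.\<close>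

lemma Cinf_zero_outside_derivative_bounded:
  fixes f :: "'a::euclidean_space \<Rightarrow> real"
  assumes f: "Cinf f" and zero: "\<And>x. norm x > 1 \<Longrightarrow> f x = 0"
  obtains L where "\<And>x h. \<bar>frechet_derivative f (at x) h\<bar> \<le> L * norm h" "L \<ge> 0"
proof -
  have "\<exists>K. \<forall>x. \<bar>frechet_derivative f (at x) b\<bar> \<le> K" if "b \<in> Basis" for b
    using Cinf_zero_outside_bounded[OF Cinf_partial[OF f that]]
    by (metis frechet_derivative_zero_outside zero)
  then obtain K where K: "\<And>x b. b \<in> Basis \<Longrightarrow> \<bar>frechet_derivative f (at x) b\<bar> \<le> K b"
    by metis
  have "\<bar>frechet_derivative f (at x) h\<bar> \<le> (\<Sum>b\<in>Basis. K b) * norm h" for x h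
  proof -
    interpret linear "frechet_derivative f (at x)"
      using Cinf_has_derivative[OF f] has_derivative_linear by blast
    have "frechet_derivative f (at x) h = (\<Sum>b\<in>Basis. (h \<bullet> b) * frechet_derivative f (at x) b)"
      by (subst euclidean_representation[of h, symmetric], subst sum, simp add: scale)
    also have "\<bar>\<dots>\<bar> \<le> (\<Sum>b\<in>Basis. norm h * K b)"
      by (intro order_trans[OF sum_abs] sum_mono)
         (auto simp: abs_mult intro!: mult_mono Basis_le_norm K)
    finally show ?thesis by (simp add: sum_distrib_left mult.commute)
  qed
  moreover have "(\<Sum>b\<in>Basis. K b) \<ge> 0"
    by (intro sum_nonneg) (use K[of _ 0] in force)
  ultimately show thesis by (rule that)
qed

text \<open>A partial derivative of the series has the same shape: \<open>\<phi>\<close> is replaced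
  by its partial derivative and \<open>c k\<close> by \<open>c k / \<epsilon> k\<close>. Summability
  for every \<open>n\<close> survives this, as \<open>n\<close> is only shifted by one, so the
  coinduction invariant fixes centres and scales and lets profile and coefficients vary.\<close>

lemma Cinf_bump_series:
  fixes \<phi> :: "'a::euclidean_space \<Rightarrow> real" and X :: "nat \<Rightarrow> 'a" and \<epsilon> c :: "nat \<Rightarrow> real"
  assumes "Cinf \<phi>" and "\<And>x. norm x > 1 \<Longrightarrow> \<phi> x = 0" and \<epsilon>: "\<And>k. \<epsilon> k > 0"
    and "\<And>n. summable (\<lambda>k. \<bar>c k\<bar> / \<epsilon> k ^ n)"
  shows "Cinf (\<lambda>x. \<Sum>k. c k * \<phi> ((x - X k) /\<^sub>R \<epsilon> k))"
proof (rule Cinf_coinduct_derivative[where P = "\<lambda>g. \<exists>\<psi> c. Cinf \<psi> \<and> (\<forall>x. norm x > 1 \<longrightarrow> \<psi> x = 0) \<and>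
      (\<forall>n. summable (\<lambda>k. \<bar>c k\<bar> / \<epsilon> k ^ n)) \<and> g = (\<lambda>x. \<Sum>k. c k * \<psi> ((x - X k) /\<^sub>R \<epsilon> k))"], goal_cases)
  case 1
  then show ?case using assms by blast
next
  case (2 g)
  then obtain \<psi> c where \<psi>: "Cinf \<psi>" and zero: "\<And>x. norm x > 1 \<Longrightarrow> \<psi> x = 0"
    and c: "\<And>n. summable (\<lambda>k. \<bar>c k\<bar> / \<epsilon> k ^ n)"
    and g: "g = (\<lambda>x. \<Sum>k. c k * \<psi> ((x - X k) /\<^sub>R \<epsilon> k))" by blast
  obtain K where K: "\<And>x. \<bar>\<psi> x\<bar> \<le> K" using Cinf_zero_outside_bounded[OF \<psi> zero] by blast
  obtain L where L: "\<And>x h. \<bar>frechet_derivative \<psi> (at x) h\<bar> \<le> L * norm h" "L \<ge> 0"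
    using Cinf_zero_outside_derivative_bounded[OF \<psi> zero] by blast
  define D where "D k x h = c k / \<epsilon> k * frechet_derivative \<psi> (at ((x - X k) /\<^sub>R \<epsilon> k)) h" for k x h
  define C where "C k = L * \<bar>c k / \<epsilon> k\<bar>" for k
  have c1: "summable C"
    unfolding C_def using c[of 1] \<epsilon> by (intro summable_mult) (simp add: abs_of_pos)
  have D_le: "\<bar>D k x h\<bar> \<le> C k * norm h" for k x h
    using mult_left_mono[OF L(1), of "\<bar>c k / \<epsilon> k\<bar>"] by (simp add: D_def C_def abs_mult ac_simps)
  have D_summable: "summable (\<lambda>k. D k x h)" for x h
    using D_le by (intro summable_comparison_test'[OF summable_mult2[OF c1, of "norm h"]]) simp
  have D_deriv: "((\<lambda>x. c k * \<psi> ((x - X k) /\<^sub>R \<epsilon> k)) has_derivative D k x) (at x)" for k x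
  proof -
    have "((\<lambda>x. (x - X k) /\<^sub>R \<epsilon> k) has_derivative (\<lambda>h. h /\<^sub>R \<epsilon> k)) (at x)"
      by (auto intro!: derivative_eq_intros)
    from has_derivative_mult_right[OF has_derivative_compose[OF this Cinf_has_derivative[OF \<psi>]], of "c k"]
    have "((\<lambda>x. c k * \<psi> ((x - X k) /\<^sub>R \<epsilon> k)) has_derivative
       (\<lambda>h. c k * frechet_derivative \<psi> (at ((x - X k) /\<^sub>R \<epsilon> k)) (h /\<^sub>R \<epsilon> k))) (at x)" .
    moreover have "linear (frechet_derivative \<psi> (at y))" for y
      using Cinf_has_derivative[OF \<psi>] has_derivative_linear by blast
    ultimately show ?thesis
      by (simp add: D_def[abs_def] linear_scale divide_inverse mult.assoc)
  qed
  have g_deriv: "(g has_derivative (\<lambda>h. \<Sum>k. D k x h)) (at x)" for x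
  proof -
    have "\<exists>g. \<forall>x\<in>UNIV. (\<lambda>k. c k * \<psi> ((x - X k) /\<^sub>R \<epsilon> k)) sums g x \<and>
        (g has_derivative (\<lambda>h. \<Sum>k. D k x h)) (at x within UNIV)"
    proof (rule has_derivative_series[where f' = D])
      fix e :: real assume "e > 0"
      \<comment> \<open>The tail of the dominating series bounds the error of the differentiated
        partial sums uniformly in \<open>x\<close>.\<close>
      have "(\<lambda>n. \<Sum>k. C (k + n)) \<longlonglongrightarrow> 0"
        by (rule suminf_exist_split2[OF c1])
      then have "\<forall>\<^sub>F n in sequentially. (\<Sum>k. C (k + n)) < e"
        using \<open>e > 0\<close> by (rule order_tendstoD)
      then show "\<forall>\<^sub>F n in sequentially. \<forall>x\<in>UNIV. \<forall>h.
          norm ((\<Sum>i<n. D i x h) - (\<Sum>k. D k x h)) \<le> e * norm h"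
      proof eventually_elim
        case (elim n)
        have "norm ((\<Sum>i<n. D i x h) - (\<Sum>k. D k x h)) \<le> e * norm h" for x h
        proof -
          have *: "summable (\<lambda>k. C (k + n) * norm h)"
            by (intro summable_mult2 summable_ignore_initial_segment[OF c1])
          have "norm ((\<Sum>i<n. D i x h) - (\<Sum>k. D k x h)) = \<bar>\<Sum>k. D (k + n) x h\<bar>"
            using suminf_split_initial_segment[OF D_summable, of x h n] by simp
          also have "\<dots> \<le> (\<Sum>k. C (k + n) * norm h)"
            using norm_suminf_le[OF _ *, of "\<lambda>k. D (k + n) x h"] D_le by simp
          also have "\<dots> = (\<Sum>k. C (k + n)) * norm h"
            by (rule suminf_mult2[symmetric]) (rule summable_ignore_initial_segment[OF c1])
          also have "\<dots> \<le> e * norm h" using elim by (intro mult_right_mono) auto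
          finally show ?thesis .
        qed
        then show ?case by blast
      qed
    next
      \<comment> \<open>The rule for differentiating series asks for convergence of the series
        itself at one point; the origin is taken.\<close>
      show "(\<lambda>k. c k * \<psi> ((0 - X k) /\<^sub>R \<epsilon> k)) sums (\<Sum>k. c k * \<psi> ((0 - X k) /\<^sub>R \<epsilon> k))"
      proof (rule summable_sums, rule summable_comparison_test'[of "\<lambda>k. \<bar>c k\<bar> * K" 0])
        show "summable (\<lambda>k. \<bar>c k\<bar> * K)" using c[of 0] by (intro summable_mult2) simp
      qed (auto simp: abs_mult intro!: mult_left_mono K)
    qed (auto simp: D_deriv)
    then obtain g' where g': "\<And>x. (\<lambda>k. c k * \<psi> ((x - X k) /\<^sub>R \<epsilon> k)) sums g' x"
       "\<And>x. (g' has_derivative (\<lambda>h. \<Sum>k. D k x h)) (at x)" by auto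
    then have "g' = g" by (auto simp: g sums_iff)
    with g'(2) show ?thesis by simp
  qed
  show ?case
  proof (intro exI[of _ "\<lambda>x h. \<Sum>k. D k x h"] conjI allI ballI g_deriv)
    fix b :: 'a assume b: "b \<in> Basis"
    show "\<exists>\<psi>' c'. Cinf \<psi>' \<and> (\<forall>x. norm x > 1 \<longrightarrow> \<psi>' x = 0) \<and>
      (\<forall>n. summable (\<lambda>k. \<bar>c' k\<bar> / \<epsilon> k ^ n)) \<and> (\<lambda>x. \<Sum>k. D k x b) = (\<lambda>x. \<Sum>k. c' k * \<psi>' ((x - X k) /\<^sub>R \<epsilon> k))"
    proof (intro exI[of _ "\<lambda>x. frechet_derivative \<psi> (at x) b"] exI[of _ "\<lambda>k. c k / \<epsilon> k"] conjI allI impI)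
      fix n
      show "summable (\<lambda>k. \<bar>c k / \<epsilon> k\<bar> / \<epsilon> k ^ n)"
        using c[of "Suc n"] \<epsilon> by (simp add: abs_of_pos)
    qed (use Cinf_partial[OF \<psi> b] frechet_derivative_zero_outside[of \<psi>, OF zero] in \<open>auto simp: D_def\<close>)
  qed
qed

subsection \<open>Finite differences of a bump series\<close>

text \<open>The points \<open>x\<close> are chosen such that \<open>x + m r \<theta>\<close> lies just inside the support of the bump, on
  the side of \<open>- \<theta>\<close>. All other nodes \<open>x + j r \<theta>\<close> then lie outside it, so that only the term
  \<open>j = m\<close>, with coefficient \<open>1\<close> or \<open>-1\<close>, survives.\<close>
lemma delta_op_bump_ge:
  fixes \<theta> X x :: "'a::euclidean_space"
  assumes u: "\<And>z. norm (z - X) \<le> 3 * \<epsilon> \<Longrightarrow>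
      u z = a * flat_exp 0 (1 - ((z - X) /\<^sub>R \<epsilon>) \<bullet> ((z - X) /\<^sub>R \<epsilon>))"
    and pos: "\<epsilon> > 0" "a \<ge> 0" and \<theta>: "norm \<theta> = 1"
    and m: "m \<ge> 1" and \<rho>: "1 / (2 * real m) \<le> \<rho>" "\<rho> \<le> 1 / real m"
    and x: "norm (x - (X - (\<epsilon> * (1 - \<rho> / 2 + real m * \<rho>)) *\<^sub>R \<theta>)) < \<epsilon> * \<rho> / 4"
  shows "a * exp (- 8 * real m) \<le> \<bar>delta_op m u x ((\<epsilon> * \<rho>) *\<^sub>R \<theta>)\<bar>"
proof -
  \<comment> \<open>In coordinates centred at \<open>X\<close> and scaled by
    \<open>\<epsilon>\<close>, the node \<open>j = m\<close> is \<open>w\<close>, and node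
    \<open>j\<close> is \<open>w - d *\<^sub>R \<theta>\<close> with
    \<open>d = (m - j) * \<rho>\<close>. The choice of \<open>x\<close> puts \<open>w\<close> within
    \<open>\<rho> / 4\<close> of \<open>- (1 - \<rho> / 2) *\<^sub>R \<theta>\<close>.\<close>
  define w where "w = (x - X) /\<^sub>R \<epsilon> + (real m * \<rho>) *\<^sub>R \<theta>"
  have \<rho>0: "\<rho> > 0" using \<rho>(1) m by (smt (verit) of_nat_0_less_iff zero_less_divide_iff One_nat_def Suc_le_lessD)
  have m\<rho>: "real m * \<rho> \<le> 1" using \<rho>(2) m by (simp add: field_simps)
  have \<rho>1: "\<rho> \<le> 1" using m\<rho> m \<rho>0 by (smt (verit) mult_le_cancel_right1 of_nat_1 of_nat_mono)
  have \<epsilon>w: "\<epsilon> *\<^sub>R w = x - X + (\<epsilon> * (real m * \<rho>)) *\<^sub>R \<theta>"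
    using pos by (simp add: w_def scaleR_add_right)
  have w: "norm (w + (1 - \<rho> / 2) *\<^sub>R \<theta>) < \<rho> / 4"
  proof -
    have "x - (X - (\<epsilon> * (1 - \<rho> / 2 + real m * \<rho>)) *\<^sub>R \<theta>) = \<epsilon> *\<^sub>R (w + (1 - \<rho> / 2) *\<^sub>R \<theta>)"
      unfolding scaleR_add_right \<epsilon>w by (simp add: algebra_simps)
    then have "norm (x - (X - (\<epsilon> * (1 - \<rho> / 2 + real m * \<rho>)) *\<^sub>R \<theta>)) = \<epsilon> * norm (w + (1 - \<rho> / 2) *\<^sub>R \<theta>)"
      using pos by simp
    with x have "\<epsilon> * norm (w + (1 - \<rho> / 2) *\<^sub>R \<theta>) < \<epsilon> * (\<rho> / 4)" by simp
    then show ?thesis using pos by simp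
  qed
  have uw: "u (x + of_int j *\<^sub>R (\<epsilon> * \<rho>) *\<^sub>R \<theta>) = a * flat_exp 0 (1 - (norm (w - d *\<^sub>R \<theta>))\<^sup>2)"
    and le: "norm (w - d *\<^sub>R \<theta>) \<le> 1 - \<rho> / 4 + d" and ge: "1 - 3 * \<rho> / 4 + d < norm (w - d *\<^sub>R \<theta>)"
    if j: "j \<in> {- int m..int m}" and d: "d = (real m - of_int j) * \<rho>" for j d
  proof -
    have d0: "d \<ge> 0" using j \<rho>0 by (simp add: d)
    have "d \<le> 2 * (real m * \<rho>)" using j \<rho>0 by (simp add: d mult.assoc[symmetric])
    with m\<rho> have d2: "d \<le> 2" by linarith
    have "norm (w - d *\<^sub>R \<theta> + (1 - \<rho> / 2 + d) *\<^sub>R \<theta>) < \<rho> / 4"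
      using w by (simp add: algebra_simps)
    moreover have "norm ((1 - \<rho> / 2 + d) *\<^sub>R \<theta>) = 1 - \<rho> / 2 + d"
      using d0 \<rho>1 by (simp add: \<theta>)
    ultimately show le: "norm (w - d *\<^sub>R \<theta>) \<le> 1 - \<rho> / 4 + d" and "1 - 3 * \<rho> / 4 + d < norm (w - d *\<^sub>R \<theta>)"
      using norm_triangle_ineq4[of "w - d *\<^sub>R \<theta> + (1 - \<rho> / 2 + d) *\<^sub>R \<theta>" "(1 - \<rho> / 2 + d) *\<^sub>R \<theta>"]
        norm_diff_ineq[of "(1 - \<rho> / 2 + d) *\<^sub>R \<theta>" "w - d *\<^sub>R \<theta>"]
      by (simp_all add: add.commute)
    have eq: "x + of_int j *\<^sub>R (\<epsilon> * \<rho>) *\<^sub>R \<theta> - X = \<epsilon> *\<^sub>R (w - d *\<^sub>R \<theta>)"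
      unfolding scaleR_diff_right \<epsilon>w d by (simp add: algebra_simps)
    \<comment> \<open>Since d \<le> 2, every node stays within \<open>3 * \<epsilon>\<close> of
      \<open>X\<close>, where \<open>u\<close> is given by the single bump.\<close>
    have "norm (w - d *\<^sub>R \<theta>) \<le> 3" using le d2 \<rho>0 by linarith
    then have "norm (x + of_int j *\<^sub>R (\<epsilon> * \<rho>) *\<^sub>R \<theta> - X) \<le> 3 * \<epsilon>"
      unfolding eq using pos by simp
    from u[OF this, unfolded eq] show "u (x + of_int j *\<^sub>R (\<epsilon> * \<rho>) *\<^sub>R \<theta>) = a * flat_exp 0 (1 - (norm (w - d *\<^sub>R \<theta>))\<^sup>2)"
      using pos by (simp add: power2_norm_eq_inner)
  qed
  have zero: "u (x + of_int j *\<^sub>R (\<epsilon> * \<rho>) *\<^sub>R \<theta>) = 0" if "j \<in> {- int m..int m} - {int m}" for j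
  proof -
    define d where "d = (real m - of_int j) * \<rho>"
    have "real m - of_int j \<ge> 1" using that by auto
    \<comment> \<open>One step of length \<open>\<rho>\<close> already moves the node out to norm
      above \<open>1 + \<rho> / 4\<close>.\<close>
    then have "d \<ge> \<rho>" using \<rho>0 by (simp add: d_def)
    moreover have "1 - 3 * \<rho> / 4 + d < norm (w - d *\<^sub>R \<theta>)"
      using that by (intro ge[OF _ d_def]) auto
    ultimately have "norm (w - d *\<^sub>R \<theta>) > 1" using \<rho>0 by linarith
    then have "1 - (norm (w - d *\<^sub>R \<theta>))\<^sup>2 \<le> 0"
      by (simp add: power2_eq_square less_1_mult less_imp_le)
    then show ?thesis using uw[of j d] that by (simp add: d_def flat_exp_def)
  qed
  have "delta_op m u x ((\<epsilon> * \<rho>) *\<^sub>R \<theta>) =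
      (\<Sum>j\<in>{int m}. (-1) ^ nat \<bar>j\<bar> * real ((2 * m) choose nat (int m - j)) * u (x + of_int j *\<^sub>R (\<epsilon> * \<rho>) *\<^sub>R \<theta>))"
    unfolding delta_op_def by (rule sum.mono_neutral_right) (use zero in auto)
  also have "\<bar>\<dots>\<bar> = \<bar>u (x + of_int (int m) *\<^sub>R (\<epsilon> * \<rho>) *\<^sub>R \<theta>)\<bar>"
    by (simp add: abs_mult)
  also have "\<dots> = a * flat_exp 0 (1 - (norm w)\<^sup>2)"
    using uw[of "int m" 0] pos by (simp add: flat_exp_def)
  also have "\<dots> \<ge> a * exp (- 8 * real m)"
  proof -
    \<comment> \<open>This gives \<open>1 - (norm w)\<^sup>2\<close> \<ge> \<open>\<rho> / 4\<close>
      \<ge> \<open>1 / (8 * m)\<close>, whence the exponent \<open>- 8 * m\<close>.\<close>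
    have "norm w \<le> 1 - \<rho> / 4" using le[of "int m" 0] by simp
    moreover have "(norm w)\<^sup>2 \<le> norm w"
      using calculation \<rho>0 by (simp add: power2_eq_square mult_left_le)
    moreover have "\<rho> / 4 \<ge> 1 / (8 * real m)" using \<rho>(1) by simp
    ultimately have t: "1 - (norm w)\<^sup>2 \<ge> 1 / (8 * real m)" by linarith
    have "1 / (8 * real m) > 0" using m by simp
    with t have t0: "1 - (norm w)\<^sup>2 > 0" by linarith
    moreover have "1 / (1 - (norm w)\<^sup>2) \<le> 8 * real m"
      using t t0 m by (simp add: field_simps)
    ultimately show ?thesis using pos by (simp add: flat_exp_def mult_left_mono)
  qed
  finally show ?thesis .
qed

text \<open>Only \<open>r\<close> between \<open>\<epsilon> / (2 * m)\<close> and
  \<open>\<epsilon> / m\<close> is kept, and for each such \<open>r\<close> only the ball of good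
  points \<open>x\<close>. The factors are the least weight, the length of the radial interval, the
  squared pointwise bound and the least volume of the ball.\<close>

lemma nn_integral_delta_op_bump_ge:
  fixes \<theta> X :: "'a::euclidean_space"
  assumes u: "\<And>z. norm (z - X) \<le> 3 * \<epsilon> \<Longrightarrow>
      u z = a * flat_exp 0 (1 - ((z - X) /\<^sub>R \<epsilon>) \<bullet> ((z - X) /\<^sub>R \<epsilon>))"
    and pos: "\<epsilon> > 0" "\<epsilon> \<le> 1" "a \<ge> 0" and \<theta>: "norm \<theta> = 1"
    and m: "m \<ge> 1" and s: "real m - 1 \<le> s"
  shows "ennreal (\<epsilon> powr (1 - 2 * real m) * (\<epsilon> / (2 * real m)) *
      ((a * exp (- 8 * real m))\<^sup>2 * (unit_ball_vol DIM('a) * (\<epsilon> / (8 * real m)) ^ DIM('a)))) \<le>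
    (\<integral>\<^sup>+ r. indicator {0<..} r * ennreal (r powr (-1 - 2 * s)) *
      (\<integral>\<^sup>+ x. ennreal ((delta_op m u x (r *\<^sub>R \<theta>))\<^sup>2) \<partial>lborel) \<partial>lborel)"
    (is "ennreal (?p * ?l * (?b * ?V)) \<le> _")
proof -
  have inner: "ennreal (?b * ?V) \<le> (\<integral>\<^sup>+ x. ennreal ((delta_op m u x (r *\<^sub>R \<theta>))\<^sup>2) \<partial>lborel)"
    if r: "r \<in> {\<epsilon> / (2 * real m)..\<epsilon> / real m}" for r
  proof -
    define \<rho> where "\<rho> = r / \<epsilon>"
    have r_eq: "r = \<epsilon> * \<rho>" using pos by (simp add: \<rho>_def)
    have \<rho>: "1 / (2 * real m) \<le> \<rho>" "\<rho> \<le> 1 / real m"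
      using r pos m by (simp_all add: \<rho>_def field_simps)
    have \<rho>0: "0 \<le> \<rho>" using \<rho>(1) by (rule order_trans[rotated]) simp
    define B where "B = ball (X - (\<epsilon> * (1 - \<rho> / 2 + real m * \<rho>)) *\<^sub>R \<theta>) (\<epsilon> * \<rho> / 4)"
    have "?V \<le> unit_ball_vol DIM('a) * (\<epsilon> * \<rho> / 4) ^ DIM('a)"
      using r pos unfolding r_eq by (intro mult_left_mono power_mono) auto
    then have "ennreal (?b * ?V) \<le> ennreal ?b * ennreal (unit_ball_vol DIM('a) * (\<epsilon> * \<rho> / 4) ^ DIM('a))"
      by (subst ennreal_mult''[symmetric]) (use \<rho>0 pos in \<open>auto intro!: ennreal_leI mult_left_mono\<close>)
    also have "\<dots> = ennreal ?b * emeasure lborel B"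
      unfolding B_def using \<rho>0 pos by (simp add: emeasure_ball)
    also have "\<dots> = (\<integral>\<^sup>+ x. ennreal ?b * indicator B x \<partial>lborel)"
      by (simp add: B_def nn_integral_cmult_indicator)
    also have "\<dots> \<le> (\<integral>\<^sup>+ x. ennreal ((delta_op m u x (r *\<^sub>R \<theta>))\<^sup>2) \<partial>lborel)"
    proof (rule nn_integral_mono)
      fix x :: 'a
      show "ennreal ?b * indicator B x \<le> ennreal ((delta_op m u x (r *\<^sub>R \<theta>))\<^sup>2)"
      proof (cases "x \<in> B")
        case True
        then have "a * exp (- 8 * real m) \<le> \<bar>delta_op m u x (r *\<^sub>R \<theta>)\<bar>"
          unfolding r_eq using pos
          by (intro delta_op_bump_ge[OF u _ _ \<theta> m \<rho>]) (auto simp: B_def dist_norm norm_minus_commute)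
        then have "?b \<le> (delta_op m u x (r *\<^sub>R \<theta>))\<^sup>2"
          using pos by (metis abs_le_square_iff abs_of_nonneg exp_ge_zero mult_nonneg_nonneg)
        then show ?thesis using True by (simp add: ennreal_leI)
      qed simp
    qed
    finally show ?thesis .
  qed
  have p: "?p \<le> r powr (-1 - 2 * s)" if r: "r \<in> {\<epsilon> / (2 * real m)..\<epsilon> / real m}" for r
  proof -
    have "\<epsilon> / real m \<le> \<epsilon>" using m pos by (simp add: field_simps)
    moreover have "\<epsilon> / (2 * real m) > 0" using m pos by simp
    ultimately have r': "0 < r" "r \<le> \<epsilon>" using r by auto
    \<comment> \<open>Both exponents are negative, \<open>r\<close> \<le> \<open>\<epsilon>\<close>
      \<le> 1, and \<open>s\<close> \<ge> \<open>m - 1\<close> gives \<open>-1 - 2 * s\<close> \<le>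
      \<open>1 - 2 * m\<close>; the bound is thus free of \<open>s\<close>.\<close>
    have "?p \<le> r powr (1 - 2 * real m)" using r' m by (intro powr_mono2') auto
    also have "\<dots> \<le> r powr (-1 - 2 * s)" using r' s pos by (intro powr_mono') auto
    finally show ?thesis .
  qed
  have "\<epsilon> / real m - \<epsilon> / (2 * real m) = ?l" by (simp add: field_simps)
  then have "emeasure lborel {\<epsilon> / (2 * real m)..\<epsilon> / real m} = ennreal ?l"
    using pos m by (simp add: field_simps)
  moreover have "ennreal (?p * ?l * (?b * ?V)) = ennreal ?p * ennreal (?b * ?V) * ennreal ?l"
    using pos by (simp add: ennreal_mult'[symmetric] ennreal_mult''[symmetric] ac_simps)
  ultimately have "ennreal (?p * ?l * (?b * ?V)) =
      (\<integral>\<^sup>+ r. ennreal ?p * ennreal (?b * ?V) * indicator {\<epsilon> / (2 * real m)..\<epsilon> / real m} r \<partial>lborel)"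
    by (simp add: nn_integral_cmult_indicator)
  also have "\<dots> \<le> (\<integral>\<^sup>+ r. indicator {0<..} r * ennreal (r powr (-1 - 2 * s)) *
      (\<integral>\<^sup>+ x. ennreal ((delta_op m u x (r *\<^sub>R \<theta>))\<^sup>2) \<partial>lborel) \<partial>lborel)"
  proof (rule nn_integral_mono)
    fix r :: real
    show "ennreal ?p * ennreal (?b * ?V) * indicator {\<epsilon> / (2 * real m)..\<epsilon> / real m} r \<le>
      indicator {0<..} r * ennreal (r powr (-1 - 2 * s)) *
      (\<integral>\<^sup>+ x. ennreal ((delta_op m u x (r *\<^sub>R \<theta>))\<^sup>2) \<partial>lborel)"
    proof (cases "r \<in> {\<epsilon> / (2 * real m)..\<epsilon> / real m}")
      case True
      moreover have "\<epsilon> / (2 * real m) > 0" using m pos by simp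
      ultimately have "r > 0" by auto
      then show ?thesis
        using True inner[OF True] p[OF True] by (simp add: mult_mono ennreal_leI)
    qed simp
  qed
  finally show ?thesis .
qed

text \<open>The scales are chosen after \<open>c\<close>, so the lower bound \<open>1 / c m\<close>
  may grow as fast as desired in \<open>m\<close>. Smallness of the scales helps both smoothness and
  growth.\<close>

lemma exists_bump_series:
  fixes c :: "nat \<Rightarrow> real"
  assumes c: "\<And>k. c k > 0"
  shows "\<exists>u::'a::euclidean_space \<Rightarrow> real. u \<in> Cc_inf (ball 0 1) \<and>
    (\<forall>m s \<theta>. m \<ge> DIM('a) + 3 \<longrightarrow> real m - 1 \<le> s \<longrightarrow> norm \<theta> = 1 \<longrightarrow>
      ennreal (1 / c m) \<le> (\<integral>\<^sup>+ r. indicator {0<..} r * ennreal (r powr (-1 - 2 * s)) *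
        (\<integral>\<^sup>+ x. ennreal ((delta_op m u x (r *\<^sub>R \<theta>))\<^sup>2) \<partial>lborel) \<partial>lborel))"
proof -
  define \<phi> :: "'a \<Rightarrow> real" where "\<phi> = (\<lambda>x. flat_exp 0 (1 - x \<bullet> x))"
  \<comment> \<open>The factor of the lower bound for the \<open>m\<close>-th bump that does not
    depend on the scale.\<close>
  define g where "g m = exp (- 8 * real m) ^ 2 * unit_ball_vol DIM('a) / (2 * real m * (8 * real m) ^ DIM('a))" for m
  \<comment> \<open>The first entry of the minimum separates the bumps, the second forces the
    growth. Index 0 is set apart because \<open>g 0 = 0\<close> by division by zero.\<close>
  define \<epsilon> where "\<epsilon> k = (if k = 0 then 1 / 32 else min ((1 / 2) ^ k / 32) (g k * c k))" for k
  obtain v :: 'a where v: "norm v = 1" using nonempty_Basis norm_Basis by blast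
  define X where "X k = (1 / 2) ^ (k + 2) *\<^sub>R v" for k
  \<comment> \<open>The exponent \<open>k div 2\<close> is unbounded, so \<open>a k\<close> beats
    every fixed power of \<open>\<epsilon> k\<close>; its double is at most \<open>k\<close>, so
    \<open>(a k)\<^sup>2\<close> stays above \<open>\<epsilon> k ^ k\<close>.\<close>
  define a where "a k = \<epsilon> k ^ (k div 2)" for k
  define u where "u = (\<lambda>x. \<Sum>k. a k * \<phi> ((x - X k) /\<^sub>R \<epsilon> k))"
  have g: "g k > 0" if "k > 0" for k using that by (simp add: g_def)
  have \<epsilon>: "\<epsilon> k > 0" for k using g[of k] c[of k] by (simp add: \<epsilon>_def)
  have \<epsilon>_le: "\<epsilon> k \<le> (1 / 2) ^ k / 32" for k by (simp add: \<epsilon>_def del: times_divide_eq_left divide_le_eq_numeral1 le_divide_eq_numeral1)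
  have \<epsilon>_1: "\<epsilon> k \<le> 1" for k using \<epsilon>_le[of k] power_le_one[of "1 / 2 :: real" k] by simp
  have a: "a k > 0" for k using \<epsilon> by (simp add: a_def)
  have \<phi>_0: "\<phi> x = 0" if "norm x \<ge> 1" for x
    using one_le_power[OF that, of 2] by (simp add: \<phi>_def flat_exp_def power2_norm_eq_inner[symmetric])
  have "Cinf u" unfolding u_def
  proof (rule Cinf_bump_series[OF _ _ \<epsilon>])
    show "Cinf \<phi>" unfolding \<phi>_def by (intro bump_alg_Cinf bump_alg.flat)
    show "summable (\<lambda>k. \<bar>a k\<bar> / \<epsilon> k ^ n)" for n
    proof (rule summable_comparison_test'[of "\<lambda>k. (1 / 2) ^ k" "2 * n + 2"])
      fix k assume "k \<ge> 2 * n + 2"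
      \<comment> \<open>From this index on at least one power of \<open>\<epsilon> k\<close> is left
        after division by \<open>\<epsilon> k ^ n\<close>.\<close>
      then have "k div 2 = n + Suc (k div 2 - n - 1)" by linarith
      then have "a k / \<epsilon> k ^ n = \<epsilon> k ^ Suc (k div 2 - n - 1)"
        unfolding a_def using \<epsilon>[of k] by (metis nonzero_mult_div_cancel_left power_add power_not_zero less_irrefl)
      also have "\<dots> \<le> \<epsilon> k" using \<epsilon>[of k] \<epsilon>_1[of k] by (simp add: mult_left_le power_le_one)
      also have "\<dots> \<le> (1 / 2) ^ k" using \<epsilon>_le[of k] by (rule order_trans) simp
      finally show "norm (\<bar>a k\<bar> / \<epsilon> k ^ n) \<le> (1 / 2) ^ k" using a[of k] \<epsilon>[of k] by simp
    qed simp
  qed (simp add: \<phi>_0)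
  moreover have supp: "fun_support u \<subseteq> cball 0 (1 / 2)"
    unfolding fun_support_def
  proof (rule closure_minimal, safe)
    fix x assume "u x \<noteq> 0"
    then obtain k where "\<phi> ((x - X k) /\<^sub>R \<epsilon> k) \<noteq> 0"
      unfolding u_def by fastforce
    then have "norm ((x - X k) /\<^sub>R \<epsilon> k) \<le> 1" using \<phi>_0 by force
    then have "norm (x - X k) \<le> \<epsilon> k" using \<epsilon>[of k] by (simp add: divide_inverse[symmetric] mult.commute[of "inverse _"])
    then have "norm x \<le> \<epsilon> k + norm (X k)" using norm_triangle_sub[of x "X k"] by linarith
    also have "\<dots> \<le> (1 / 2) ^ k * (1 / 32 + 1 / 4)"
      using \<epsilon>_le[of k] by (simp add: X_def v power2_eq_square algebra_simps)
    also have "\<dots> \<le> 1 * (1 / 32 + 1 / 4)" by (intro mult_right_mono power_le_one) auto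
    finally show "x \<in> cball 0 (1 / 2)" by simp
  qed
  ultimately have "u \<in> Cc_inf (ball 0 1)"
    by (auto simp: Cc_inf_def fun_support_def compact_eq_bounded_closed dest: subsetD
        intro: bounded_subset[OF bounded_cball])
  moreover have local: "u z = a k * flat_exp 0 (1 - ((z - X k) /\<^sub>R \<epsilon> k) \<bullet> ((z - X k) /\<^sub>R \<epsilon> k))"
    if z: "norm (z - X k) \<le> 3 * \<epsilon> k" for z k
  proof -
    \<comment> \<open>Every other bump vanishes within \<open>3 * \<epsilon> k\<close> of
      \<open>X k\<close>, so there the series reduces to its \<open>k\<close>-th term.\<close>
    have "\<phi> ((z - X j) /\<^sub>R \<epsilon> j) = 0" if "j \<noteq> k" for j
    proof -
      define p q :: real where "p = (1 / 2) ^ j" and "q = (1 / 2) ^ k"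
      have pq: "p > 0" "q > 0" by (simp_all add: p_def q_def)
      have half: "(1 / 2) ^ n \<le> (1 / 2 :: real) ^ l / 2" if "l < n" for l n :: nat
        using power_decreasing[of "Suc l" n "1 / 2 :: real"] that by simp
      have e: "\<epsilon> j \<le> p / 32" "\<epsilon> k \<le> q / 32" 
        using \<epsilon>_le[of j] \<epsilon>_le[of k] by (simp_all add: p_def q_def)
      have "X j - X k = ((p - q) / 4) *\<^sub>R v"
        by (simp add: X_def p_def q_def power_add scaleR_diff_left diff_divide_distrib)
      then have "norm (X j - X k) = \<bar>p - q\<bar> / 4" by (simp add: v)
      \<comment> \<open>The smaller of \<open>p\<close> and \<open>q\<close> is at most half the
        larger, so the centres are at least an eighth of the larger apart; this exceeds the distance
        allowed for \<open>z\<close> plus the radius of bump \<open>j\<close>.\<close>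
      moreover have "\<bar>p - q\<bar> / 4 \<ge> 3 * (q / 32) + p / 32"
      proof (cases "j < k")
        case True
        then have "q \<le> p / 2" unfolding p_def q_def by (rule half)
        then show ?thesis using pq by (simp add: abs_if)
      next
        case False
        then have "p \<le> q / 2" unfolding p_def q_def using \<open>j \<noteq> k\<close> by (intro half) auto
        then show ?thesis using pq by (simp add: abs_if)
      qed
      moreover have "norm (X j - X k) \<le> norm (z - X k) + norm (z - X j)"
        using norm_triangle_ineq4[of "z - X k" "z - X j"] by simp
      ultimately have "norm (z - X j) \<ge> \<epsilon> j" using z e by linarith
      then show ?thesis using \<epsilon>[of j] by (intro \<phi>_0) (simp add: divide_inverse[symmetric] mult.commute[of "inverse _"])
    qed
    then have "u z = (\<Sum>j\<in>{k}. a j * \<phi> ((z - X j) /\<^sub>R \<epsilon> j))"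
      unfolding u_def by (intro suminf_finite) auto
    then show ?thesis by (simp add: \<phi>_def)
  qed
  moreover have "ennreal (1 / c m) \<le> (\<integral>\<^sup>+ r. indicator {0<..} r * ennreal (r powr (-1 - 2 * s)) *
        (\<integral>\<^sup>+ x. ennreal ((delta_op m u x (r *\<^sub>R \<theta>))\<^sup>2) \<partial>lborel) \<partial>lborel)"
    if m: "m \<ge> DIM('a) + 3" and s: "real m - 1 \<le> s" and \<theta>: "norm \<theta> = 1" for m s and \<theta> :: 'a
  proof -
    have m0: "m \<ge> 1" using m by simp
    have "1 / c m \<le> g m / \<epsilon> m"
    proof -
      have "\<epsilon> m \<le> g m * c m" using m0 by (simp add: \<epsilon>_def)
      then show ?thesis using c[of m] \<epsilon>[of m] by (simp add: field_simps)
    qed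
    also have "\<dots> = g m * \<epsilon> m powr (-1)" using \<epsilon>[of m] by (simp add: powr_minus divide_inverse)
    \<comment> \<open>The new exponent \<open>2 - m + DIM('a)\<close> is at most \<open>-1\<close>
      precisely when \<open>m\<close> \<ge> \<open>DIM('a) + 3\<close>, and the base is at most
      1.\<close>
    also have "\<dots> \<le> g m * \<epsilon> m powr (2 - 2 * real m + real m + real DIM('a))"
      using \<epsilon>[of m] \<epsilon>_1[of m] m g[of m] m0 by (intro mult_left_mono powr_mono') auto
    also have "\<dots> = g m * (\<epsilon> m powr (1 - 2 * real m) * \<epsilon> m * \<epsilon> m ^ m * \<epsilon> m ^ DIM('a))"
      using \<epsilon>[of m] by (simp add: powr_realpow[symmetric] powr_mult_base powr_add[symmetric] mult.commute[of _ "\<epsilon> m"])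
    also have "\<dots> \<le> g m * (\<epsilon> m powr (1 - 2 * real m) * \<epsilon> m * (a m)\<^sup>2 * \<epsilon> m ^ DIM('a))"
    proof -
      have "\<epsilon> m ^ m \<le> (a m)\<^sup>2"
        unfolding a_def power_mult[symmetric] using \<epsilon>[of m] \<epsilon>_1[of m] by (intro power_decreasing) auto
      then show ?thesis using g[of m] m0 \<epsilon>[of m] by (intro mult_left_mono mult_right_mono) auto
    qed
    also have "\<dots> = \<epsilon> m powr (1 - 2 * real m) * (\<epsilon> m / (2 * real m)) *
      ((a m * exp (- 8 * real m))\<^sup>2 * (unit_ball_vol DIM('a) * (\<epsilon> m / (8 * real m)) ^ DIM('a)))"
      using m0 unfolding g_def power_mult_distrib power_divide by (simp add: field_simps)
    finally have "ennreal (1 / c m) \<le> ennreal \<dots>" by (rule ennreal_leI)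
    also have "\<dots> \<le> (\<integral>\<^sup>+ r. indicator {0<..} r * ennreal (r powr (-1 - 2 * s)) *
        (\<integral>\<^sup>+ x. ennreal ((delta_op m u x (r *\<^sub>R \<theta>))\<^sup>2) \<partial>lborel) \<partial>lborel)"
      by (rule nn_integral_delta_op_bump_ge[where X = "X m"])
         (use local \<epsilon> \<epsilon>_1 a \<theta> m0 s in \<open>auto intro: less_imp_le\<close>)
    finally show ?thesis .
  qed
  ultimately show ?thesis by blast
qed

subsection \<open>The normalising constant\<close>

text \<open>Near 0, \<open>1 - cos t\<close> \<le> \<open>r\<^sup>2\<close> leaves the exponent
  \<open>4 * m - 1 - 2 * s\<close>, positive as \<open>s < m\<close>. Far out,
  \<open>1 - cos t\<close> \<le> 2 and \<open>s\<close> \<ge> 1, which follows from \<open>m\<close>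
  \<ge> 2, give decay at least \<open>1 / r\<^sup>2\<close>. The majorant does not depend on
  \<open>s\<close>.\<close>

lemma one_minus_cos_powr_le:
  fixes r t :: real
  assumes t: "\<bar>t\<bar> \<le> r" and r: "r > 0" and m: "m \<ge> 2" and s: "real m - 1 \<le> s" "s < real m"
  shows "r powr (-1 - 2 * s) * (1 - cos t) ^ (2 * m) \<le>
    indicator {0..1} r + 4 ^ m * (indicator {1..} r * (1 / r\<^sup>2))"
proof -
  have cos0: "1 - cos t \<ge> 0" by simp
  show ?thesis
  proof (cases "r \<le> 1")
    case True
    have "(sin (t / 2))\<^sup>2 \<le> (t / 2)\<^sup>2"
      using abs_sin_x_le_abs_x by (rule abs_le_square_iff[THEN iffD1])
    then have "cos t \<ge> 1 - t\<^sup>2 / 2"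
      using cos_double_sin[of "t / 2"] by (simp add: power_divide)
    moreover have "t\<^sup>2 \<le> r\<^sup>2" using t r by (simp add: abs_le_square_iff[symmetric])
    ultimately have "1 - cos t \<le> r\<^sup>2" using zero_le_power2[of r] by linarith
    then have "(1 - cos t) ^ (2 * m) \<le> (r\<^sup>2) ^ (2 * m)" using cos0 by (intro power_mono)
    also have "\<dots> = r powr (4 * real m)"
      using powr_realpow[OF r, of "4 * m"] by (simp add: power_mult[symmetric])
    finally have "r powr (-1 - 2 * s) * (1 - cos t) ^ (2 * m) \<le> r powr (-1 - 2 * s) * r powr (4 * real m)"
      by (intro mult_left_mono) auto
    also have "\<dots> = r powr (4 * real m - 1 - 2 * s)" by (simp add: powr_add[symmetric] algebra_simps)
    also have "\<dots> \<le> 1" using r True s m by (intro powr_le1) auto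
    also have "\<dots> \<le> indicator {0..1} r + 4 ^ m * (indicator {1..} r * (1 / r\<^sup>2))"
      using r True by simp
    finally show ?thesis .
  next
    case False
    have "(1 - cos t) ^ (2 * m) \<le> 2 ^ (2 * m)"
      using cos0 cos_ge_minus_one[of t] by (intro power_mono) linarith+
    also have "\<dots> = (4::real) ^ m" by (simp add: power_mult)
    finally have c: "(1 - cos t) ^ (2 * m) \<le> 4 ^ m" .
    have "r powr (-1 - 2 * s) \<le> r powr (- 2)" using False s m by (intro powr_mono) auto
    also have "\<dots> = 1 / r\<^sup>2" using r by (simp add: powr_minus_divide)
    finally have "r powr (-1 - 2 * s) * (1 - cos t) ^ (2 * m) \<le> 1 / r\<^sup>2 * 4 ^ m"
      using c by (intro mult_mono) auto
    then show ?thesis using False by simp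
  qed
qed

text \<open>Upper bound: the radial majorant integrates to \<open>1 + 4 ^ m\<close> on almost every
  ray, and \<open>sg\<close> has mass 1. Positivity: if the integral vanished, almost every
  direction would be orthogonal to \<open>e\<close>, and \<open>M_fun s sg e\<close> would be
  0.\<close>

lemma nn_integral_one_minus_cos_nu_meas:
  fixes sg :: "'a::euclidean_space measure"
  assumes prob: "prob_space sg" and sg: "sets sg = sets borel" and sphere: "AE th in sg. norm th = 1"
    and e: "norm e = 1" and m: "m \<ge> 2" and s: "real m - 1 \<le> s" "s < real m"
  shows "(\<integral>\<^sup>+ y. ennreal ((1 - cos (e \<bullet> y)) ^ (2 * m)) \<partial>nu_meas s sg) \<le> ennreal (1 + 4 ^ m)"
    and "M_fun s sg e > 0 \<Longrightarrow> (\<integral>\<^sup>+ y. ennreal ((1 - cos (e \<bullet> y)) ^ (2 * m)) \<partial>nu_meas s sg) > 0"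
proof -
  interpret prob_space sg by fact
  note [measurable_cong] = sg
  let ?h = "\<lambda>r th. indicator {0<..} r * ennreal (r powr (-1 - 2 * s)) * ennreal ((1 - cos (e \<bullet> (r *\<^sub>R th))) ^ (2 * m))"
  have J: "(\<integral>\<^sup>+ y. ennreal ((1 - cos (e \<bullet> y)) ^ (2 * m)) \<partial>nu_meas s sg) =
      (\<integral>\<^sup>+ th. (\<integral>\<^sup>+ r. ?h r th \<partial>lborel) \<partial>sg)"
    by (rule nn_integral_nu_meas[OF prob sg]) measurable
  have tail: "(\<integral>\<^sup>+ r. ennreal (1 / r\<^sup>2) * indicator {1..} r \<partial>lborel) = ennreal (0 - (- 1 / 1))"
  proof (rule nn_integral_FTC_atLeast[where F = "\<lambda>x. - 1 / x"])
    fix x :: real assume "1 \<le> x"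
    then show "((\<lambda>x. - 1 / x) has_real_derivative 1 / x\<^sup>2) (at x)"
      by (auto intro!: derivative_eq_intros simp: power2_eq_square)
  next
    show "((\<lambda>x::real. - 1 / x) \<longlongrightarrow> 0) at_top"
      by (intro tendsto_divide_0[OF tendsto_const] filterlim_at_top_imp_at_infinity filterlim_ident)
  qed auto
  have le: "(\<integral>\<^sup>+ r. ?h r th \<partial>lborel) \<le> ennreal (1 + 4 ^ m)" if th: "norm th = 1" for th
  proof -
    have "(\<integral>\<^sup>+ r. ?h r th \<partial>lborel) \<le>
      (\<integral>\<^sup>+ r. indicator {0..1::real} r + ennreal (4 ^ m) * (ennreal (1 / r\<^sup>2) * indicator {1..} r) \<partial>lborel)"
    proof (rule nn_integral_mono)
      fix r :: real
      show "?h r th \<le> indicator {0..1} r + ennreal (4 ^ m) * (ennreal (1 / r\<^sup>2) * indicator {1..} r)"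
      proof (cases "r > 0")
        case True
        have "\<bar>e \<bullet> (r *\<^sub>R th)\<bar> \<le> r"
          using Cauchy_Schwarz_ineq2[of e "r *\<^sub>R th"] True by (simp add: e th)
        from one_minus_cos_powr_le[OF this True m s]
        have "ennreal (r powr (-1 - 2 * s) * (1 - cos (e \<bullet> (r *\<^sub>R th))) ^ (2 * m)) \<le>
          ennreal (indicator {0..1} r + 4 ^ m * (indicator {1..} r * (1 / r\<^sup>2)))" by (rule ennreal_leI)
        also have "\<dots> = ennreal (indicator {0..1} r) +
            ennreal (4 ^ m) * (ennreal (1 / r\<^sup>2) * ennreal (indicator {1..} r))"
          by (subst ennreal_plus)
            (auto simp: indicator_def ennreal_mult' mult.assoc[symmetric] simp del: times_divide_eq_right)
        finally show ?thesis
          using True by (simp add: ennreal_mult' ennreal_indicator)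
      qed simp
    qed
    also have "\<dots> = ennreal (1 + 4 ^ m)"
      using tail by (subst ennreal_plus) (simp_all add: nn_integral_add nn_integral_cmult)
    finally show ?thesis .
  qed
  have "(\<integral>\<^sup>+ th. (\<integral>\<^sup>+ r. ?h r th \<partial>lborel) \<partial>sg) \<le> (\<integral>\<^sup>+ th. ennreal (1 + 4 ^ m) \<partial>sg)"
    by (intro nn_integral_mono_AE eventually_mono[OF sphere] le)
  then show "(\<integral>\<^sup>+ y. ennreal ((1 - cos (e \<bullet> y)) ^ (2 * m)) \<partial>nu_meas s sg) \<le> ennreal (1 + 4 ^ m)"
    by (simp add: J emeasure_space_1)
  have pos: "e \<bullet> th = 0" if "norm th = 1" "(\<integral>\<^sup>+ r. ?h r th \<partial>lborel) = 0" for th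
  proof (rule ccontr)
    assume nz: "e \<bullet> th \<noteq> 0"
    have "AE r in lborel. ?h r th = 0"
      using that(2) by (subst (asm) nn_integral_0_iff_AE) auto
    then have "AE r in lborel. \<not> (r \<in> {0<..1::real})"
    proof eventually_elim
      case (elim r)
      show ?case
      proof
        assume r: "r \<in> {0<..1}"
        \<comment> \<open>For \<open>r\<close> in \<open>{0<..1}\<close> the argument is nonzero and
          of modulus at most 1, below pi, so its cosine is strictly less than 1 and the integrand is
          positive.\<close>
        have le1: "\<bar>e \<bullet> (r *\<^sub>R th)\<bar> \<le> 1"
          using Cauchy_Schwarz_ineq2[of e "r *\<^sub>R th"] r by (simp add: e that(1))
        have "cos (e \<bullet> (r *\<^sub>R th)) = cos \<bar>e \<bullet> (r *\<^sub>R th)\<bar>" by (simp only: cos_abs_real)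
        also have "\<dots> < cos 0"
          using le1 nz r pi_gt3 by (intro cos_monotone_0_pi) auto
        finally have "(1 - cos (e \<bullet> (r *\<^sub>R th))) ^ (2 * m) > 0" by (intro zero_less_power) simp
        then show False using elim r by (simp add: ennreal_mult'[symmetric] ennreal_eq_0_iff not_le del: inner_scaleR_right)
      qed
    qed
    then have "emeasure lborel {0<..1::real} = 0"
      by (subst (asm) AE_iff_measurable[of "{0<..1}"]) auto
    then show False by simp
  qed
  assume M: "M_fun s sg e > 0"
  show "(\<integral>\<^sup>+ y. ennreal ((1 - cos (e \<bullet> y)) ^ (2 * m)) \<partial>nu_meas s sg) > 0"
  proof (rule ccontr)
    assume "\<not> ?thesis"
    then have "(\<integral>\<^sup>+ th. (\<integral>\<^sup>+ r. ?h r th \<partial>lborel) \<partial>sg) = 0" by (simp add: J)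
    then have "AE th in sg. (\<integral>\<^sup>+ r. ?h r th \<partial>lborel) = 0"
      by (subst (asm) nn_integral_0_iff_AE) auto
    with sphere have "AE th in sg. \<bar>e \<bullet> th\<bar> powr (2 * s) = 0"
      by eventually_elim (use pos in simp)
    then have "M_fun s sg e = (\<integral>th. 0 \<partial>sg)"
      unfolding M_fun_def by (intro integral_cong_AE) auto
    with M show False by simp
  qed
qed

text \<open>An upper bound for the integral gives a lower bound for its reciprocal. Finiteness and
  positivity both matter: \<open>enn2real\<close> sends infinity to 0, and division by 0 would make
  the constant 0.\<close>

lemma c_const_ge:
  fixes sg :: "'a::euclidean_space measure"
  assumes "prob_space sg" "sets sg = sets borel" "AE th in sg. norm th = 1"
    and "norm e = 1" "m \<ge> 2" "real m - 1 \<le> s" "s < real m" and M: "M_fun s sg e > 0"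
  shows "1 / (4 ^ m * (1 + 4 ^ m)) \<le> c_const (2 * m) s sg e / 2"
proof -
  define j where "j = enn2real (\<integral>\<^sup>+ y. ennreal ((1 - cos (e \<bullet> y)) ^ (2 * m)) \<partial>nu_meas s sg)"
  note J = nn_integral_one_minus_cos_nu_meas[OF assms(1-7)]
  have "j \<le> 1 + 4 ^ m" "j > 0"
    using J(1) J(2)[OF M] unfolding j_def
    by (auto simp: enn2real_positive_iff enn2real_leI intro: le_less_trans)
  then have "1 / (4 ^ m * (1 + 4 ^ m)) \<le> 1 / (4 ^ m * j)"
    by (intro divide_left_mono mult_left_mono mult_pos_pos) (auto intro: add_pos_pos)
  also have "\<dots> = c_const (2 * m) s sg e / 2"
  proof -
    have "2 ^ (2 * m) = (4 :: real) ^ m" by (simp add: power_mult)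
    then show ?thesis unfolding c_const_def j_def[symmetric] by simp
  qed
  finally show ?thesis .
qed

subsection \<open>Blow-up of the energy\<close>

text \<open>The radial bound \<open>K\<close> is the same in every direction, so averaging over the
  probability measure \<open>sg\<close> preserves it; the polar form turns the average into the
  double integral of the energy.\<close>

lemma energy_ge:
  fixes sg :: "'a::euclidean_space measure"
  assumes prob: "prob_space sg" and sg: "sets sg = sets borel" and sphere: "AE th in sg. norm th = 1"
    and e: "norm e = 1" and m: "m \<ge> 2" and s: "real m - 1 \<le> s" "s < real m" and M: "M_fun s sg e > 0"
    and u: "continuous_on UNIV u"
    and K: "\<And>\<theta>. norm \<theta> = 1 \<Longrightarrow> ennreal K \<le> (\<integral>\<^sup>+ r. indicator {0<..} r * ennreal (r powr (-1 - 2 * s)) *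
        (\<integral>\<^sup>+ x. ennreal ((delta_op m u x (r *\<^sub>R \<theta>))\<^sup>2) \<partial>lborel) \<partial>lborel)"
  shows "ennreal (1 / (4 ^ m * (1 + 4 ^ m)) * K) \<le> energy s sg e u"
proof -
  interpret prob_space sg by fact
  have [measurable]: "u \<in> borel_measurable borel"
    using u by (rule borel_measurable_continuous_onI)
  \<comment> \<open>As \<open>s_one s\<close> is strictly larger than \<open>s\<close>, the left
    endpoint \<open>m - 1\<close> also has order \<open>m\<close>.\<close>
  have "\<lfloor>s\<rfloor> = int m - 1" using s by (intro floor_unique) auto
  then have s1: "s_one s = m" by (simp add: s_one_def)
  let ?F = "\<lambda>y. \<integral>\<^sup>+ x. ennreal ((delta_op m u x y)\<^sup>2) \<partial>lborel"
  have "ennreal K = (\<integral>\<^sup>+ th. ennreal K \<partial>sg)" by (simp add: emeasure_space_1)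
  also have "\<dots> \<le> (\<integral>\<^sup>+ th. (\<integral>\<^sup>+ r. indicator {0<..} r * ennreal (r powr (-1 - 2 * s)) *
      ?F (r *\<^sub>R th) \<partial>lborel) \<partial>sg)"
    by (intro nn_integral_mono_AE eventually_mono[OF sphere] K)
  also have "\<dots> = (\<integral>\<^sup>+ y. ?F y \<partial>nu_meas s sg)"
    by (rule nn_integral_nu_meas[OF prob sg, symmetric]) (unfold delta_op_def, measurable)
  finally have "ennreal (1 / (4 ^ m * (1 + 4 ^ m))) * ennreal K \<le>
      ennreal (c_const (2 * m) s sg e / 2) * (\<integral>\<^sup>+ y. ?F y \<partial>nu_meas s sg)"
    by (intro mult_mono ennreal_leI c_const_ge[OF prob sg sphere e m s M]) auto
  moreover have "s \<noteq> 0" using m s by auto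
  ultimately show ?thesis
    by (simp add: energy_def s1 ennreal_mult'[symmetric])
qed

text \<open>Otherwise all intervals far out are null, and so is their countable union, which
  contains the unit ball around a distant support point.\<close>

lemma infinite_charged_unit_intervals:
  fixes \<mu> :: "real measure"
  assumes sets: "sets \<mu> = sets borel" and nonneg: "emeasure \<mu> {..<0} = 0"
    and supp: "\<not> bounded (measure_support \<mu>)"
  shows "infinite {m. m \<ge> N \<and> emeasure \<mu> {real m - 1..<real m} > 0}" (is "infinite ?S")
proof
  assume "finite ?S"
  then obtain B where B: "\<forall>m\<in>?S. m < B"
    unfolding finite_nat_set_iff_bounded ..
  \<comment> \<open>The margin 2 keeps the unit ball around a positive \<open>x\<close> above
    \<open>B + N + 1\<close>.\<close>
  obtain x where x: "x \<in> measure_support \<mu>" "\<bar>x\<bar> > real (B + N + 2)"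
    using supp unfolding bounded_iff by (metis not_le real_norm_def)
  have charged: "emeasure \<mu> (ball x d) > 0" if "d > 0" for d
    using x(1) that by (simp add: measure_support_def)
  show False
  proof (cases "x < 0")
    case True
    \<comment> \<open>For negative \<open>x\<close> the ball of radius \<open>\<bar>x\<bar>\<close>
      stops at 0, so it lies in the null half-line.\<close>
    then have "emeasure \<mu> (ball x \<bar>x\<bar>) \<le> emeasure \<mu> {..<0}"
      by (intro emeasure_mono) (auto simp: sets dist_real_def)
    with nonneg charged[of "\<bar>x\<bar>"] True show False by simp
  next
    case False
    have "(\<Union>m\<in>{B + N..}. {real m - 1..<real m}) \<in> null_sets \<mu>"
    proof (rule null_sets_UN')
      fix m assume m: "m \<in> {B + N..}"
      then have "\<not> m < B" by simp
      with B have "m \<notin> ?S" by blast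
      with m show "{real m - 1..<real m} \<in> null_sets \<mu>"
        by (simp add: null_sets_def sets)
    qed auto
    then have "emeasure \<mu> (\<Union>m\<in>{B + N..}. {real m - 1..<real m}) = 0" by blast
    moreover have "emeasure \<mu> (ball x 1) \<le> emeasure \<mu> (\<Union>m\<in>{B + N..}. {real m - 1..<real m})"
    proof (rule emeasure_mono)
      show "ball x 1 \<subseteq> (\<Union>m\<in>{B + N..}. {real m - 1..<real m})"
      proof
        fix y assume "y \<in> ball x 1"
        then have y: "y > real (B + N + 1)" using x False by (auto simp: dist_real_def)
        then have "y \<in> {real (nat (\<lfloor>y\<rfloor> + 1)) - 1..<real (nat (\<lfloor>y\<rfloor> + 1))}" by auto
        moreover have "nat (\<lfloor>y\<rfloor> + 1) \<in> {B + N..}" using y by (simp add: le_nat_iff) linarith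
        ultimately show "y \<in> (\<Union>m\<in>{B + N..}. {real m - 1..<real m})" by blast
      qed
    qed (auto simp: sets)
    ultimately show False using charged[of 1] by simp
  qed
qed

theorem theorem5p4:
  fixes \<sigma> :: "real \<Rightarrow> 'a::euclidean_space measure"
    and e :: "real \<Rightarrow> 'a"
    and \<mu> :: "real measure"
  assumes sigma_prob: "\<And>s. s > 0 \<Longrightarrow> prob_space (\<sigma> s)"
    and sigma_sets: "\<And>s. s > 0 \<Longrightarrow> sets (\<sigma> s) = sets borel"
    and sigma_sphere: "\<And>s. s > 0 \<Longrightarrow> emeasure (\<sigma> s) (sphere 0 1) = 1"
    and e_sphere: "\<And>s. s > 0 \<Longrightarrow> e s \<in> sphere 0 1"
    and e_max: "\<And>s e'. s > 0 \<Longrightarrow> e' \<in> sphere 0 1 \<Longrightarrow> M_fun s (\<sigma> s) e' \<le> M_fun s (\<sigma> s) (e s)"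
    and mu_sets: "sets \<mu> = sets borel"
    and mu_finite: "finite_measure \<mu>"
    and mu_nonneg: "emeasure \<mu> {..<0} = 0"
    and mu_supp: "\<not> bounded (measure_support \<mu>)"
    and inf_pos: "(INF s\<in>{0<..}. M_fun s (\<sigma> s) (e s)) > 0"
    and nu_meas: "\<And>A. A \<in> sets borel \<Longrightarrow> (\<lambda>s. emeasure (nu_meas s (\<sigma> s)) A) \<in> borel_measurable \<mu>"
  shows "\<exists>u \<in> Cc_inf (ball 0 1). (\<integral>\<^sup>+ s. energy s (\<sigma> s) (e s) u \<partial>\<mu>) = \<infinity>"
proof -
  interpret \<mu>: finite_measure \<mu> by fact
  define I where "I m = {real m - 1..<real m}" for m :: nat
  have I_sets: "I m \<in> sets \<mu>" for m by (simp add: I_def mu_sets)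
  define \<kappa> :: "nat \<Rightarrow> real" where "\<kappa> m = 1 / (4 ^ m * (1 + 4 ^ m))" for m
  have \<kappa>: "\<kappa> m > 0" for m by (simp add: \<kappa>_def add_pos_pos)
  \<comment> \<open>With this choice a charged interval contributes at least
    \<open>\<kappa> m / c m * measure \<mu> (I m) = 1\<close>. The value 1 elsewhere only keeps
    \<open>c\<close> positive.\<close>
  define c where "c m = (if measure \<mu> (I m) > 0 then \<kappa> m * measure \<mu> (I m) else 1)" for m
  have c: "c m > 0" for m using \<kappa> by (simp add: c_def)
  define S where "S = {m. m \<ge> DIM('a) + 3 \<and> emeasure \<mu> (I m) > 0}"
  have S: "infinite S"
    unfolding S_def I_def by (rule infinite_charged_unit_intervals[OF mu_sets mu_nonneg mu_supp])
  obtain u :: "'a \<Rightarrow> real" where u: "u \<in> Cc_inf (ball 0 1)" and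
    K: "\<And>m s \<theta>. m \<ge> DIM('a) + 3 \<Longrightarrow> real m - 1 \<le> s \<Longrightarrow> norm \<theta> = 1 \<Longrightarrow>
      ennreal (1 / c m) \<le> (\<integral>\<^sup>+ r. indicator {0<..} r * ennreal (r powr (-1 - 2 * s)) *
        (\<integral>\<^sup>+ x. ennreal ((delta_op m u x (r *\<^sub>R \<theta>))\<^sup>2) \<partial>lborel) \<partial>lborel)"
    using exists_bump_series[of c, OF c, where 'a = 'a] by blast
  have M: "M_fun s (\<sigma> s) (e s) > 0" if "s > 0" for s
  proof -
    \<comment> \<open>A real infimum bounds its family from below only if the family is bounded
      below; here 0 is a lower bound.\<close>
    have "bdd_below ((\<lambda>s. M_fun s (\<sigma> s) (e s)) ` {0<..})"
      by (rule bdd_belowI2[of _ 0]) (simp add: M_fun_def)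
    then have "(INF s\<in>{0<..}. M_fun s (\<sigma> s) (e s)) \<le> M_fun s (\<sigma> s) (e s)"
      using that by (intro cINF_lower) auto
    with inf_pos show ?thesis by linarith
  qed
  have energy: "ennreal (\<kappa> m / c m) \<le> energy s (\<sigma> s) (e s) u" if m: "m \<in> S" and s: "s \<in> I m" for m s
  proof -
    have m': "m \<ge> DIM('a) + 3" using m by (simp add: S_def)
    have s': "real m - 1 \<le> s" "s < real m" using s by (auto simp: I_def)
    have s0: "s > 0" using m' s' by linarith
    interpret prob_space "\<sigma> s" using sigma_prob s0 .
    have "AE th in \<sigma> s. th \<in> sphere 0 1"
      using sigma_sphere[OF s0] by (intro AE_prob_1) (simp add: emeasure_eq_measure)
    then have "AE th in \<sigma> s. norm th = 1" by simp
    moreover have "norm (e s) = 1" using e_sphere[OF s0] by simp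
    ultimately show ?thesis
      using energy_ge[OF sigma_prob[OF s0] sigma_sets[OF s0] _ _ _ s' M[OF s0] _ K[OF m' s'(1)]] m' u
      by (simp add: \<kappa>_def Cc_inf_def Cinf_continuous_on)
  qed
  have "of_nat n \<le> (\<integral>\<^sup>+ s. energy s (\<sigma> s) (e s) u \<partial>\<mu>)" for n
  proof -
    \<comment> \<open>Any \<open>n\<close> charged intervals together contribute at least
      \<open>n\<close>, by comparison with a simple function supported on them.\<close>
    obtain F where F: "finite F" "card F = n" "F \<subseteq> S"
      using infinite_arbitrarily_large[OF S] by blast
    have "of_nat n = (\<Sum>m\<in>F. ennreal (\<kappa> m / c m) * emeasure \<mu> (I m))"
    proof -
      have "ennreal (\<kappa> m / c m) * emeasure \<mu> (I m) = 1" if "m \<in> F" for m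
      proof -
        have "measure \<mu> (I m) > 0"
          using that F(3) by (auto simp: S_def \<mu>.emeasure_eq_measure)
        then show ?thesis
          using \<kappa>[of m] by (simp add: c_def \<mu>.emeasure_eq_measure ennreal_mult'[symmetric])
      qed
      then show ?thesis using F(2) by simp
    qed
    also have "\<dots> = (\<integral>\<^sup>+ s. (\<Sum>m\<in>F. ennreal (\<kappa> m / c m) * indicator (I m) s) \<partial>\<mu>)"
      using I_sets by (simp add: nn_integral_sum nn_integral_cmult_indicator)
    also have "\<dots> \<le> (\<integral>\<^sup>+ s. energy s (\<sigma> s) (e s) u \<partial>\<mu>)"
    proof (rule nn_integral_mono)
      fix s
      show "(\<Sum>m\<in>F. ennreal (\<kappa> m / c m) * indicator (I m) s) \<le> energy s (\<sigma> s) (e s) u"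
      proof (cases "\<exists>m\<in>F. s \<in> I m")
        case True
        then obtain m where m: "m \<in> F" "s \<in> I m" by blast
        \<comment> \<open>The half-open intervals are disjoint, so only the term of the interval
          containing \<open>s\<close> is nonzero.\<close>
        have "(\<Sum>k\<in>F. ennreal (\<kappa> k / c k) * indicator (I k) s) =
            (\<Sum>k\<in>{m}. ennreal (\<kappa> k / c k) * indicator (I k) s)"
          by (rule sum.mono_neutral_right) (use m F(1) in \<open>auto simp: I_def indicator_def\<close>)
        also have "\<dots> \<le> energy s (\<sigma> s) (e s) u" using m F(3) energy[of m s] by auto
        finally show ?thesis .
      qed (simp add: indicator_def)
    qed
    finally show ?thesis .
  qed
  then have "(\<integral>\<^sup>+ s. energy s (\<sigma> s) (e s) u \<partial>\<mu>) = \<infinity>"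
    using ennreal_Ex_less_of_nat by (metis infinity_ennreal_def leD top.not_eq_extremum)
  with u show ?thesis by blast
qed

end
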